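(* Let $\mathcal{P}=(X,\preceq)$ be a finite poset and let $G_{\mathcal{P}}$ be its underlying comparability graph. Then $\operatorname{ldim}(\mathcal{P})\le 2\operatorname{pdim}(G_{\mathcal{P}})+1$.
   Context: All posets and graphs are finite. The underlying comparability graph $G_{\mathcal{P}}$ of a poset $\mathcal{P}=(X,\preceq)$ is the simple graph with vertex set $X$ in which two distinct elements are adjacent if and only if they are comparable in $\mathcal{P}$. A partial linear extension (ple) of $\mathcal{P}$ is a linear extension of any subposet of $\mathcal{P}$. A local realizer of $\mathcal{P}$ is a family $\mathcal{L}=\{L_1,\dots,L_l\}$ of ple's of $\mathcal{P}$ such that (1) if $x\preceq y$ in $\mathcal{P}$ then there is at least one $L_i\in\mathcal{L}$ with $x\preceq_{L_i}y$; and (2) if $x$ and $y$ are incomparable in $\mathcal{P}$ then there are $L_i,L_j\in\mathcal{L}$ with $x\preceq_{L_i}y$ and $y\preceq_{L_j}x$. Here $x\preceq_{L}y$ means that both $x,y$ are elements of $L$ and $x\preceq y$ in $L$. For $x\in X$ let $\mu_x(\mathcal{L})$ be the number of ple's in $\mathcal{L}$ that contain $x$, and let $\mu(\mathcal{L})=\max_x\mu_x(\mathcal{L})$. The local dimension $\operatorname{ldim}(\mathcal{P})$ is the minimum of $\mu(\mathcal{L})$ over all local realizers $\mathcal{L}$ of $\mathcal{P}$. The product dimension $\operatorname{pdim}(G)$ of a graph $G$ is the minimum positive integer $k$ for which there exists a function $f:V(G)\to\mathbb{N}^k$ such that $uv\in E(G)$ if and only if $f(u)$ and $f(v)$ differ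 in exactly $k$ coordinates (i.e. in every coordinate). *)

theory Defs
  imports Main
begin

definition linear_extension :: "'a set \<Rightarrow> 'a rel \<Rightarrow> 'a rel \<Rightarrow> bool" where
  "linear_extension A s L \<longleftrightarrow> linear_order_on A L \<and> s \<subseteq> L"

(* A ple carries no separate ground set: L is reflexive on A and L \<subseteq> A \<times> A, so A = Field L. *)
definition ple :: "'a set \<Rightarrow> 'a rel \<Rightarrow> 'a rel \<Rightarrow> bool" where
  "ple X r L \<longleftrightarrow> (\<exists>A \<subseteq> X. linear_extension A (Restr r A) L)"

definition local_realizer :: "'a set \<Rightarrow> 'a rel \<Rightarrow> 'a rel set \<Rightarrow> bool" where
  "local_realizer X r \<L> \<longleftrightarrow>
     finite \<L> \<and> (\<forall>L\<in>\<L>. ple X r L) \<and>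
     (\<forall>x\<in>X. \<forall>y\<in>X. (x, y) \<in> r \<longrightarrow> (\<exists>L\<in>\<L>. (x, y) \<in> L)) \<and>
     (\<forall>x\<in>X. \<forall>y\<in>X. (x, y) \<notin> r \<and> (y, x) \<notin> r \<longrightarrow>
        (\<exists>L\<in>\<L>. \<exists>L'\<in>\<L>. (x, y) \<in> L \<and> (y, x) \<in> L'))"

definition multiplicity_at :: "'a rel set \<Rightarrow> 'a \<Rightarrow> nat" where
  "multiplicity_at \<L> x = card {L \<in> \<L>. x \<in> Field L}"

(* The inserted 0 only fixes the value for the empty poset. *)
definition max_multiplicity :: "'a set \<Rightarrow> 'a rel set \<Rightarrow> nat" where
  "max_multiplicity X \<L> = Max (insert 0 (multiplicity_at \<L> ` X))"

definition ldim :: "'a set \<Rightarrow> 'a rel \<Rightarrow> nat" where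
  "ldim X r = (LEAST m. \<exists>\<L>. local_realizer X r \<L> \<and> m = max_multiplicity X \<L>)"

definition comparability_edges :: "'a set \<Rightarrow> 'a rel \<Rightarrow> 'a set set" where
  "comparability_edges X r =
     {{x, y} | x y. x \<in> X \<and> y \<in> X \<and> x \<noteq> y \<and> ((x, y) \<in> r \<or> (y, x) \<in> r)}"

(* Only the coordinates f v i with i < k are used, so f stands for a map from V to k-tuples. *)
definition product_representation ::
  "'a set \<Rightarrow> 'a set set \<Rightarrow> nat \<Rightarrow> ('a \<Rightarrow> nat \<Rightarrow> nat) \<Rightarrow> bool" where
  "product_representation V E k f \<longleftrightarrow>
     (\<forall>u\<in>V. \<forall>v\<in>V. {u, v} \<in> E \<longleftrightarrow> card {i \<in> {..<k}. f u i \<noteq> f v i} = k)"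

definition pdim :: "'a set \<Rightarrow> 'a set set \<Rightarrow> nat" where
  "pdim V E = (LEAST k. 0 < k \<and> (\<exists>f. product_representation V E k f))"

end

theory Submission
  imports Defs
begin

text \<open>
  In a product representation of the comparability graph, the elements sharing the value of a
  given coordinate form an antichain, and every incomparable pair lies in such an antichain.  An
  arbitrary linear order and its converse on each of these antichains reverse every incomparable
  pair, and each element lies in one antichain per coordinate.  One linear extension of the whole
  poset takes care of the comparable pairs.
\<close>

text \<open>Encoding orders by keys lets a linear extension, an arbitrary order of an antichain and
  its converse share one construction: injectivity of the key is all that linearity requires. The
  key type stays general because both natural and integer keys occur.\<close>

definition key_order :: "'a set \<Rightarrow> ('a \<Rightarrow> 'b::linorder) \<Rightarrow> 'a rel" where
  "key_order A key = {(x, y) \<in> A \<times> A. key x \<le> key y}"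

lemma linear_order_on_key_order:
  assumes "inj_on key A"
  shows "linear_order_on A (key_order A key)"
  using assms
  unfolding linear_order_on_def partial_order_on_def preorder_on_def refl_on_def trans_def
    antisym_def total_on_def key_order_def inj_on_def
  by (auto intro: order_trans)

lemma Field_key_order [simp]: "Field (key_order A key) = A"
  by (auto simp: key_order_def Field_def)

lemma partial_order_onD:
  assumes "partial_order_on X r"
  shows "r \<subseteq> X \<times> X" and "x \<in> X \<Longrightarrow> (x, x) \<in> r" and "trans r" and "antisym r"
  using assms by (auto simp: partial_order_on_def preorder_on_def refl_on_def)

text \<open>Sort the elements by the size of their principal down-sets, which grows strictly along
  the strict order, and break ties by a numbering of \<open>X\<close>.\<close>

lemma exists_linear_extension:
  assumes "finite X" and "partial_order_on X r"
  shows "\<exists>L. linear_extension X r L"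
proof -
  note r = partial_order_onD[OF assms(2)]
  obtain g where g: "bij_betw g X {0..<card X}"
    using ex_bij_betw_finite_nat[OF assms(1)] by blast
  define h where "h x = card {y. (y, x) \<in> r}" for x
  \<comment> \<open>The lexicographic pair of \<open>h x\<close> and \<open>g x\<close>, written as
    one number: since \<open>g x < card X\<close>, the remainder modulo \<open>card X\<close>
    recovers \<open>g x\<close>.\<close>
  define key where "key x = h x * card X + g x" for x
  have g_less: "g x < card X" if "x \<in> X" for x
    using g that by (auto simp: bij_betw_def)
  have "g x = g y" if "x \<in> X" "y \<in> X" "key x = key y" for x y
  proof -
    have "key x mod card X = key y mod card X" using that by simp
    then show ?thesis using g_less that by (simp add: key_def)
  qed
  then have "inj_on key X"
    using g unfolding bij_betw_def inj_on_def by blast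
  moreover have "key x \<le> key y" if xy: "(x, y) \<in> r" for x y
  proof (cases "x = y")
    case False
    have X: "x \<in> X" "y \<in> X" using xy r(1) by auto
    have "finite {z. (z, y) \<in> r}"
      by (rule finite_subset[OF _ assms(1)]) (use r(1) in auto)
    moreover have "{z. (z, x) \<in> r} \<subseteq> {z. (z, y) \<in> r}"
      using xy r(3) by (auto dest: transD)
    moreover have "(y, x) \<notin> r" using xy r(4) False by (auto dest: antisymD)
    moreover have "(y, y) \<in> r" using r(2) X by simp
    ultimately have "h x < h y"
      unfolding h_def by (intro psubset_card_mono) auto
    \<comment> \<open>A gain of one in \<open>h\<close> is worth \<open>card X\<close>, more than
      \<open>g x\<close> can contribute, so the tie-breaker cannot spoil the order.\<close>
    then have "Suc (h x) * card X \<le> h y * card X" by (intro mult_le_mono1) simp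
    then show ?thesis using g_less[OF X(1)] by (simp add: key_def)
  qed simp
  then have "r \<subseteq> key_order X key"
    using r(1) by (auto simp: key_order_def)
  ultimately show ?thesis
    unfolding linear_extension_def using linear_order_on_key_order by blast
qed

lemma comparability_edges_iff:
  assumes "u \<in> X" and "v \<in> X"
  shows "{u, v} \<in> comparability_edges X r \<longleftrightarrow> u \<noteq> v \<and> ((u, v) \<in> r \<or> (v, u) \<in> r)"
  using assms by (auto simp: comparability_edges_def doubleton_eq_iff)

lemma card_filter_lessThan_eq_iff:
  "card {i \<in> {..<k}. P i} = k \<longleftrightarrow> (\<forall>i<k. P i)"
proof
  assume "card {i \<in> {..<k}. P i} = k"
  then have "{i \<in> {..<k}. P i} = {..<k}" by (intro card_subset_eq) auto
  then show "\<forall>i<k. P i" by blast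
next
  assume "\<forall>i<k. P i"
  then have "{i \<in> {..<k}. P i} = {..<k}" by blast
  then show "card {i \<in> {..<k}. P i} = k" by simp
qed

text \<open>
  One coordinate for each non-adjacent pair, identifying exactly the two members of the pair.  The
  pairs may be degenerate, so that the coordinate for such a pair is injective; only in an empty
  graph are there no pairs, whence the successor in the number of coordinates.
\<close>

lemma exists_product_representation:
  assumes "finite V" and loopless: "\<And>v. v \<in> V \<Longrightarrow> {v, v} \<notin> E"
  shows "\<exists>k>0. \<exists>f. product_representation V E k f"
proof -
  obtain g :: "'a \<Rightarrow> nat" where g: "inj_on g V"
    using finite_imp_inj_to_nat_seg[OF assms(1)] by blast
  define N where "N = {(a, b) \<in> V \<times> V. {a, b} \<notin> E}"
  have "finite N"
    by (rule finite_subset[of _ "V \<times> V"]) (use assms(1) in \<open>auto simp: N_def\<close>)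
  then obtain p where p: "bij_betw p {0..<card N} N"
    using ex_bij_betw_nat_finite by blast
  \<comment> \<open>In coordinate \<open>i\<close> the second member of the pair \<open>p i\<close>
    borrows the code of the first; every other vertex keeps its own code. As \<open>g\<close> is
    injective, no other collision arises.\<close>
  define f where "f v i = (if i < card N \<and> v = snd (p i) then g (fst (p i)) else g v)" for v i
  have "{u, v} \<in> E \<longleftrightarrow> (\<forall>i<Suc (card N). f u i \<noteq> f v i)" if uv: "u \<in> V" "v \<in> V" for u v
  proof
    assume E: "{u, v} \<in> E"
    then have "u \<noteq> v" using loopless uv by auto
    show "\<forall>i<Suc (card N). f u i \<noteq> f v i"
    proof (intro allI impI)
      fix i
      show "f u i \<noteq> f v i"
      proof (cases "i < card N")
        case True
        obtain a b where ab: "p i = (a, b)" by fastforce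
        then have "(a, b) \<in> N" using p True by (force simp: bij_betw_def)
        then have "a \<in> V" "b \<in> V" "{a, b} \<notin> E" by (auto simp: N_def)
        then show ?thesis
          using E \<open>u \<noteq> v\<close> uv ab g by (auto simp: f_def inj_on_eq_iff insert_commute)
      next
        case False
        then show ?thesis using \<open>u \<noteq> v\<close> uv g by (simp add: f_def inj_on_eq_iff)
      qed
    qed
  next
    assume differ: "\<forall>i<Suc (card N). f u i \<noteq> f v i"
    show "{u, v} \<in> E"
    proof (rule ccontr)
      assume "{u, v} \<notin> E"
      then have "(u, v) \<in> p ` {0..<card N}" using uv p by (auto simp: N_def bij_betw_def)
      then obtain i where i: "i < card N" "p i = (u, v)" by (metis atLeastLessThan_iff imageE)
      then have "f u i = f v i" by (simp add: f_def)
      then show False using differ i(1) by auto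
    qed
  qed
  then have "product_representation V E (Suc (card N)) f"
    unfolding product_representation_def card_filter_lessThan_eq_iff by blast
  then show ?thesis by blast
qed

lemma ldim_le:
  assumes "finite X" and "local_realizer X r \<L>"
    and "\<And>x. x \<in> X \<Longrightarrow> multiplicity_at \<L> x \<le> m"
  shows "ldim X r \<le> m"
proof -
  have "ldim X r \<le> max_multiplicity X \<L>"
    unfolding ldim_def by (rule Least_le) (use assms(2) in blast)
  also have "\<dots> \<le> m"
    unfolding max_multiplicity_def using assms by simp
  finally show ?thesis .
qed

theorem corollary19:
  fixes X :: "'a set" and r :: "'a rel"
  assumes "finite X" and "partial_order_on X r"
  shows "ldim X r \<le> 2 * pdim X (comparability_edges X r) + 1"
proof -
  note r = partial_order_onD[OF assms(2)]
  let ?E = "comparability_edges X r"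
  define k where "k = pdim X ?E"
  \<comment> \<open>Existence ensures that the least number defining \<open>pdim\<close> is
    attained, so that a representation with exactly \<open>k\<close> coordinates can be
    taken.\<close>
  have "\<exists>k. 0 < k \<and> (\<exists>f. product_representation X ?E k f)"
    using exists_product_representation[OF assms(1), of ?E] comparability_edges_iff[of _ X _ r]
    by blast
  from LeastI_ex[OF this] obtain f where f: "product_representation X ?E k f"
    unfolding k_def pdim_def by blast
  have comparable_iff:
    "u \<noteq> v \<and> ((u, v) \<in> r \<or> (v, u) \<in> r) \<longleftrightarrow> (\<forall>i<k. f u i \<noteq> f v i)"
    if "u \<in> X" "v \<in> X" for u v
    using f comparability_edges_iff[OF that, of r] that
    unfolding product_representation_def card_filter_lessThan_eq_iff by blast
  obtain T where T: "linear_extension X r T"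
    using exists_linear_extension[OF assms] by blast
  obtain g :: "'a \<Rightarrow> nat" where g: "inj_on g X"
    using finite_imp_inj_to_nat_seg[OF assms(1)] by blast
  define C where "C i c = {x \<in> X. f x i = c}" for i c
  define up where "up i c = key_order (C i c) g" for i c
  \<comment> \<open>The key is moved to the integers so that negation reverses the order.\<close>
  define down where "down i c = key_order (C i c) (\<lambda>x. - int (g x))" for i c
  \<comment> \<open>Only values attained on \<open>X\<close> serve as indices, which keeps
    \<open>\<L>\<close> finite.\<close>
  define I where "I = (SIGMA i:{..<k}. (\<lambda>x. f x i) ` X)"
  define \<L> where "\<L> = insert T (case_prod up ` I \<union> case_prod down ` I)"
  have Field: "Field (up i c) = C i c" "Field (down i c) = C i c" for i c
    by (simp_all add: up_def down_def)
  have "finite \<L>" using assms(1) by (simp add: \<L>_def I_def)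
  moreover have "ple X r L" if "L \<in> \<L>" for L
  proof -
    have "ple X r T"
      using T r(1) unfolding ple_def by (intro exI[of _ X]) (simp add: inf_absorb1)
    moreover have "ple X r (up i c)" "ple X r (down i c)" if "(i, c) \<in> I" for i c
    proof -
      have "C i c \<subseteq> X" by (auto simp: C_def)
      have "i < k" using that by (auto simp: I_def)
      \<comment> \<open>Distinct comparable elements differ in every coordinate, but members of
        \<open>C i c\<close> agree in coordinate \<open>i\<close>. So \<open>r\<close> is trivial on
        the class and every linear order of it is a linear extension.\<close>
      have "u = v" if "(u, v) \<in> Restr r (C i c)" for u v
        using comparable_iff[of u v] that \<open>i < k\<close> by (auto simp: C_def)
      then have "Restr r (C i c) \<subseteq> key_order (C i c) key" for key :: "'a \<Rightarrow> 'b::linorder"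
        by (fastforce simp: key_order_def)
      moreover have "inj_on g (C i c)" "inj_on (\<lambda>x. - int (g x)) (C i c)"
        using inj_on_subset[OF g \<open>C i c \<subseteq> X\<close>] by (auto simp: inj_on_def)
      ultimately show "ple X r (up i c)" "ple X r (down i c)"
        unfolding ple_def linear_extension_def up_def down_def
        using \<open>C i c \<subseteq> X\<close> linear_order_on_key_order by blast+
    qed
    ultimately show ?thesis using \<open>L \<in> \<L>\<close> by (auto simp: \<L>_def)
  qed
  moreover have "\<exists>L\<in>\<L>. (x, y) \<in> L" if "(x, y) \<in> r" for x y
    using T that by (auto simp: \<L>_def linear_extension_def)
  moreover have "\<exists>L\<in>\<L>. \<exists>L'\<in>\<L>. (x, y) \<in> L \<and> (y, x) \<in> L'"
    if X: "x \<in> X" "y \<in> X" and inc: "(x, y) \<notin> r \<and> (y, x) \<notin> r" for x y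
  proof -
    obtain i where i: "i < k" "f x i = f y i"
      using comparable_iff[OF X] inc by blast
    then have "(i, f x i) \<in> I" using X by (auto simp: I_def)
    then have "up i (f x i) \<in> \<L>" "down i (f x i) \<in> \<L>" by (force simp: \<L>_def)+
    \<comment> \<open>Which alternative holds depends on how \<open>g x\<close> compares with
      \<open>g y\<close>.\<close>
    moreover have
      "(x, y) \<in> up i (f x i) \<and> (y, x) \<in> down i (f x i) \<or>
       (x, y) \<in> down i (f x i) \<and> (y, x) \<in> up i (f x i)"
      using i X by (auto simp: up_def down_def key_order_def C_def)
    ultimately show ?thesis by blast
  qed
  ultimately have realizer: "local_realizer X r \<L>"
    by (simp add: local_realizer_def)
  have "multiplicity_at \<L> x \<le> 2 * k + 1" for x
  proof -
    let ?U = "(\<lambda>i. up i (f x i)) ` {..<k}" and ?D = "(\<lambda>i. down i (f x i)) ` {..<k}"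
    \<comment> \<open>For each \<open>i\<close>, the only class that can contain \<open>x\<close> is
      the one with \<open>c = f x i\<close>. It contributes at most two orders, and \<open>T\<close>
      accounts for the final 1.\<close>
    have "{L \<in> \<L>. x \<in> Field L} \<subseteq> insert T (?U \<union> ?D)"
    proof
      fix L
      assume "L \<in> {L \<in> \<L>. x \<in> Field L}"
      then consider "L = T"
        | i c where "i < k" "L = up i c" "x \<in> C i c"
        | i c where "i < k" "L = down i c" "x \<in> C i c"
        by (auto simp: \<L>_def I_def Field)
      then show "L \<in> insert T (?U \<union> ?D)"
        by cases (auto simp: C_def)
    qed
    then have "multiplicity_at \<L> x \<le> card (insert T (?U \<union> ?D))"
      unfolding multiplicity_at_def by (intro card_mono) auto
    also have "\<dots> \<le> Suc (card (?U \<union> ?D))" by (rule card_insert_le_m1) simp_all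
    also have "\<dots> \<le> Suc (card ?U + card ?D)" using card_Un_le by simp
    also have "\<dots> \<le> 2 * k + 1"
      using card_image_le[of "{..<k}" "\<lambda>i. up i (f x i)"]
        card_image_le[of "{..<k}" "\<lambda>i. down i (f x i)"] by simp
    finally show ?thesis .
  qed
  then show ?thesis
    using ldim_le[OF assms(1) realizer] by (simp add: k_def)
qed

end
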